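(* For every real $\varepsilon>0$, the chromatic number of the graph $G_\varepsilon$ satisfies $\chi(G_\varepsilon)\geq 5$.
   Context: For $\varepsilon>0$, $G_\varepsilon$ is the (infinite) graph whose vertex set is $\mathbb{R}^2$, in which two points $x,y$ are adjacent if and only if $1-\varepsilon\leq \|x-y\|\leq 1+\varepsilon$ (Euclidean distance). The chromatic number $\chi(G)$ is the minimum number of colours in a colouring of the vertices such that adjacent vertices receive different colours (no measurability or regularity assumptions on the colour classes). *)

theory Defs
  imports "HOL-Analysis.Analysis" "HOL-Library.Extended_Nat"
begin

text \<open>A graph is given by a vertex set and an adjacency relation. Colour classes are
  arbitrary sets.\<close>

definition proper_colouring :: "'a set \<Rightarrow> ('a \<Rightarrow> 'a \<Rightarrow> bool) \<Rightarrow> ('a \<Rightarrow> 'c) \<Rightarrow> bool" where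
  "proper_colouring V adj c \<longleftrightarrow> (\<forall>x\<in>V. \<forall>y\<in>V. adj x y \<longrightarrow> c x \<noteq> c y)"

definition colourable :: "'a set \<Rightarrow> ('a \<Rightarrow> 'a \<Rightarrow> bool) \<Rightarrow> nat \<Rightarrow> bool" where
  "colourable V adj k \<longleftrightarrow> (\<exists>c :: 'a \<Rightarrow> nat. c ` V \<subseteq> {..<k} \<and> proper_colouring V adj c)"

text \<open>The value is \<open>\<infinity>\<close> (the infimum of the empty set) when finitely many colours do not
  suffice; otherwise the infimum is attained.\<close>

definition chromatic_number :: "'a set \<Rightarrow> ('a \<Rightarrow> 'a \<Rightarrow> bool) \<Rightarrow> enat" where
  "chromatic_number V adj = (INF k\<in>{k. colourable V adj k}. enat k)"

text \<open>The condition \<open>x \<noteq> y\<close> only matters for \<open>\<epsilon> \<ge> 1\<close>, where it excludes loops.\<close>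

definition annulus_adj :: "real \<Rightarrow> real ^ 2 \<Rightarrow> real ^ 2 \<Rightarrow> bool" where
  "annulus_adj \<epsilon> x y \<longleftrightarrow> x \<noteq> y \<and> 1 - \<epsilon> \<le> norm (x - y) \<and> norm (x - y) \<le> 1 + \<epsilon>"

end

theory Submission
  imports Defs
begin

text \<open>Suppose four colours suffice. On a fine square grid, a monochromatic chain of small steps cannot
  cross the forbidden annulus around its starting point, so monochromatic components have
  diameter less than 1. A Sperner-type labelling of a large grid square that is constant on
  components therefore yields a small grid simplex whose vertices lie in three different components,
  hence carry three different colours. Every point at distance 1 from this simplex has the fourth
  colour; but the unit circle contains two points at distance 1.\<close>

text \<open>Each vertex of a Kuhn simplex is the base point \<open>b\<close> with some coordinates
  raised by 1, so all vertices lie in one unit cube.\<close>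

lemma ksimplex_diff_le_1:
  assumes "ksimplex p n s" "x \<in> s" "y \<in> s"
  shows "x j \<le> y j + 1"
  using assms(1)
proof cases
  case (ksimplex b u)
  then interpret kuhn_simplex p n b u s by simp
  have "b j \<le> z j \<and> z j \<le> b j + 1" if "z \<in> s" for z
    using that by (auto simp: s_eq enum_def)
  then show ?thesis
    using assms(2,3) by (meson add_le_mono1 le_trans)
qed

text \<open>Kuhn's combinatorial lemma, applied to a labelling that is constant on the classes of
  \<open>R\<close>: vertices with different reduced labels must lie in different classes.\<close>

lemma Sperner_grid:
  fixes R :: "(nat \<Rightarrow> nat) \<Rightarrow> (nat \<Rightarrow> nat) \<Rightarrow> bool"
  assumes "equivp R" "0 < p"
    and no_crossing: "\<And>x y j. \<lbrakk>\<forall>i. x i \<le> p; \<forall>i. y i \<le> p; j < n; x j = 0; R x y\<rbrakk> \<Longrightarrow> y j < p"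
  obtains s z where "ksimplex p n s" "\<And>k. k \<le> n \<Longrightarrow> z k \<in> s"
    "\<And>k l. \<lbrakk>k \<le> n; l \<le> n; k \<noteq> l\<rbrakk> \<Longrightarrow> \<not> R (z k) (z l)"
proof -
  \<comment> \<open>Coordinate \<open>j\<close> of the label records whether the class of
    \<open>x\<close> meets the face where coordinate \<open>j\<close> is 0. A class meeting that
    face misses the opposite one by \<open>no_crossing\<close>, which gives both boundary
    conditions.\<close>
  define lab where
    "lab x j = (if \<exists>y. (\<forall>i. y i \<le> p) \<and> y j = 0 \<and> R y x then 0 else 1 :: nat)" for x j
  have lab_cong: "lab x = lab y" if "R x y" for x y
  proof -
    have "R w x \<longleftrightarrow> R w y" for w
      using equivp_symp[OF assms(1)] equivp_transp[OF assms(1)] that by blast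
    then show ?thesis
      by (simp add: lab_def fun_eq_iff)
  qed
  have "odd (card {s. ksimplex p n s \<and> (reduced n \<circ> lab) ` s = {..n}})"
  proof (rule kuhn_combinatorial[OF \<open>0 < p\<close>])
    have "lab x j = 0" if "\<forall>j. x j \<le> p" "x j = 0" for x j
    proof -
      have "(\<forall>i. x i \<le> p) \<and> x j = 0 \<and> R x x"
        by (simp add: that equivp_reflp[OF assms(1)])
      then have "\<exists>y. (\<forall>i. y i \<le> p) \<and> y j = 0 \<and> R y x"
        by (rule exI[of _ x])
      then show ?thesis
        unfolding lab_def by (rule if_P)
    qed
    then show "\<forall>x j. (\<forall>j. x j \<le> p) \<and> j < n \<and> x j = 0 \<longrightarrow> lab x j = 0"
      by blast
    have "lab x j = 1" if "\<forall>j. x j \<le> p" "j < n" "x j = p" for x j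
    proof -
      have "\<not> (\<exists>y. (\<forall>i. y i \<le> p) \<and> y j = 0 \<and> R y x)"
        using no_crossing[of _ x j] that by blast
      then show ?thesis
        unfolding lab_def by (rule if_not_P)
    qed
    then show "\<forall>x j. (\<forall>j. x j \<le> p) \<and> j < n \<and> x j = p \<longrightarrow> lab x j = 1"
      by blast
  qed
  then obtain s where s: "ksimplex p n s" and full: "(reduced n \<circ> lab) ` s = {..n}"
    using odd_card_imp_not_empty by blast
  \<comment> \<open>\<open>reduced n\<close> gives the first index below \<open>n\<close> with
    nonzero label, or \<open>n\<close> if there is none; thus there are \<open>n + 1\<close>
    values.\<close>
  have "\<exists>x\<in>s. reduced n (lab x) = k" if "k \<le> n" for k
    using full that by (force simp: set_eq_iff image_iff)
  then obtain z where z: "\<And>k. k \<le> n \<Longrightarrow> z k \<in> s \<and> reduced n (lab (z k)) = k"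
    by metis
  show thesis
  proof (rule that[OF s])
    show "\<not> R (z k) (z l)" if "k \<le> n" "l \<le> n" "k \<noteq> l" for k l
      using z[of k] z[of l] that lab_cong by metis
  qed (use z in blast)
qed

lemma unit_equilateral_triangle:
  fixes x :: "real ^ 2"
  obtains u v where "dist x u = 1" "dist x v = 1" "dist u v = 1"
proof
  let ?a = "vector [1, 0] :: real ^ 2" and ?b = "vector [1/2, sqrt 3 / 2] :: real ^ 2"
  show "dist x (x + ?a) = 1" "dist x (x + ?b) = 1" "dist (x + ?a) (x + ?b) = 1"
    by (simp_all add: dist_norm norm_vec_def L2_set_def sum_2 power_divide power2_eq_square)
qed

definition grid_point :: "real \<Rightarrow> (nat \<Rightarrow> nat) \<Rightarrow> real ^ 2" where
  "grid_point d x = vector [d * real (x 0), d * real (x 1)]"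

lemma grid_point_dist_ge:
  assumes "0 \<le> d" "j < 2"
  shows "d * \<bar>real (x j) - real (y j)\<bar> \<le> dist (grid_point d x) (grid_point d y)"
proof -
  have "\<bar>(grid_point d x - grid_point d y) $ i\<bar> \<le> dist (grid_point d x) (grid_point d y)" for i
    unfolding dist_norm by (rule component_le_norm_cart)
  from this[of 1] this[of 2] show ?thesis
    using assms by (auto simp: grid_point_def less_2_cases_iff abs_mult simp flip: right_diff_distrib)
qed

text \<open>Each coordinate contributes at most \<open>d\<close> to the l1 norm, which bounds the
  Euclidean norm.\<close>

lemma grid_point_dist_le:
  assumes "0 \<le> d" "\<And>j. x j \<le> y j + 1" "\<And>j. y j \<le> x j + 1"
  shows "dist (grid_point d x) (grid_point d y) \<le> 2 * d"
proof -
  have "\<bar>real (x j) - real (y j)\<bar> \<le> 1" for j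
    using assms(2,3)[of j] by linarith
  then have "d * \<bar>real (x j) - real (y j)\<bar> \<le> d" for j
    using assms(1) by (simp add: mult_left_le)
  from this[of 0] this[of 1] show ?thesis
    using norm_le_l1_cart[of "grid_point d x - grid_point d y"] assms(1)
    by (simp add: dist_norm grid_point_def sum_2 abs_mult flip: right_diff_distrib)
qed

lemma annulus_not_4_colourable:
  fixes c :: "real ^ 2 \<Rightarrow> nat"
  assumes "0 < \<epsilon>" "\<epsilon> < 1" "range c \<subseteq> {..<4}"
    and proper: "\<And>x y. \<lbrakk>1 - \<epsilon> \<le> dist x y; dist x y \<le> 1 + \<epsilon>\<rbrakk> \<Longrightarrow> c x \<noteq> c y"
  shows False
proof -
  \<comment> \<open>With this mesh, grid neighbours, diagonal ones included, are at distance at most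
    \<open>2 * d = \<epsilon>\<close>.\<close>
  define d where "d = \<epsilon> / 2"
  have d: "0 < d" "2 * d = \<epsilon>"
    using assms(1) by (auto simp: d_def)
  let ?g = "grid_point d"
  define near where "near x y \<longleftrightarrow> c (?g x) = c (?g y) \<and> (\<forall>j. x j \<le> y j + 1 \<and> y j \<le> x j + 1)"
    for x y :: "nat \<Rightarrow> nat"
  have near_dist: "dist (?g x) (?g y) \<le> \<epsilon>" if "near x y" for x y
    using grid_point_dist_le[of d x y] that d by (simp add: near_def)
  \<comment> \<open>One more step keeps the distance from the start below
    \<open>(1 - \<epsilon>) + \<epsilon> = 1\<close>; equal colours exclude the annulus, so it is
    again below \<open>1 - \<epsilon>\<close>. The base case needs
    \<open>\<epsilon> < 1\<close>.\<close>
  have chain: "c (?g x) = c (?g y) \<and> dist (?g x) (?g y) < 1 - \<epsilon>" if "near\<^sup>*\<^sup>* x y" for x y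
    using that
  proof induction
    case base
    then show ?case using assms(2) by simp
  next
    case (step y z)
    have "dist (?g x) (?g z) \<le> 1 + \<epsilon>"
      using step.IH near_dist[OF step.hyps(2)] dist_triangle[of "?g x" "?g z" "?g y"] assms(1)
      by linarith
    then show ?case
      using step.IH step.hyps(2) proper[of "?g x" "?g z"] by (force simp: near_def)
  qed
  have equiv: "equivp near\<^sup>*\<^sup>*"
  proof (rule equivpI)
    have "symp near"
      by (auto simp: near_def symp_def)
    then show "symp near\<^sup>*\<^sup>*"
      by (rule symp_rtranclp)
  qed (auto simp: reflp_def transp_def)
  \<comment> \<open>The side \<open>d * p\<close> of the grid square exceeds 1, so no component
    joins opposite sides.\<close>
  obtain p :: nat where p: "1 / d < real p"
    using reals_Archimedean2 by blast
  then have "0 < p"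
    using d(1) by (metis less_trans of_nat_0_less_iff zero_less_divide_1_iff)
  obtain s z where s: "ksimplex p 2 s" and z: "\<And>k :: nat. k \<le> 2 \<Longrightarrow> z k \<in> s"
    and sep: "\<And>k l :: nat. \<lbrakk>k \<le> 2; l \<le> 2; k \<noteq> l\<rbrakk> \<Longrightarrow> \<not> near\<^sup>*\<^sup>* (z k) (z l)"
  proof (rule Sperner_grid[OF equiv \<open>0 < p\<close>])
    show "y j < p" if "\<forall>i. x i \<le> p" "\<forall>i. y i \<le> p" "j < 2" "x j = 0" "near\<^sup>*\<^sup>* x y" for x y j
    proof -
      have "d * real (y j) < 1"
        using grid_point_dist_ge[of d j x y] chain[OF that(5)] that d assms(1) by simp
      also have "1 < d * real p"
        using p d by (simp add: field_simps)
      finally show ?thesis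
        using d(1) by simp
    qed
  qed (rule that)
  have close: "z k j \<le> z l j + 1" if "k \<le> 2" "l \<le> 2" for k l :: nat and j
    using ksimplex_diff_le_1[OF s z z] that by blast
  \<comment> \<open>Vertices of \<open>s\<close> are grid neighbours, so equal colours would make
    them \<open>near\<close>, against \<open>sep\<close>.\<close>
  have distinct: "c (?g (z k)) \<noteq> c (?g (z l))" if "k \<le> 2" "l \<le> 2" "k \<noteq> l" for k l :: nat
    using sep[OF that] close that unfolding near_def by blast
  obtain u v where uv: "dist (?g (z 0)) u = 1" "dist (?g (z 0)) v = 1" "dist u v = 1"
    using unit_equilateral_triangle .
  \<comment> \<open>Moving from \<open>z 0\<close> to \<open>z k\<close> changes the distance to
    \<open>w\<close> by at most \<open>\<epsilon>\<close>, so it stays within the annulus.\<close>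
  have avoid: "c (?g (z k)) \<noteq> c w" if "k \<le> 2" "dist (?g (z 0)) w = 1" for k :: nat and w
  proof (rule proper)
    have "dist (?g (z 0)) (?g (z k)) \<le> \<epsilon>"
      using grid_point_dist_le[of d "z 0" "z k"] close[of 0 k] close[of k 0] that d by simp
    then show "1 - \<epsilon> \<le> dist (?g (z k)) w" "dist (?g (z k)) w \<le> 1 + \<epsilon>"
      using that(2) dist_triangle[of "?g (z 0)" w "?g (z k)"] dist_triangle3[of "?g (z k)" w "?g (z 0)"]
      by linarith+
  qed
  \<comment> \<open>These five points have pairwise different colours.\<close>
  have "c ` {?g (z 0), ?g (z 1), ?g (z 2), u, v} \<subseteq> {..<4}"
    using assms(3) by blast
  then have "card (c ` {?g (z 0), ?g (z 1), ?g (z 2), u, v}) \<le> 4"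
    by (metis card_lessThan card_mono finite_lessThan)
  moreover have "c u \<noteq> c v"
    using proper uv(3) assms(1) by simp
  ultimately show False
    using avoid[OF _ uv(1), of 0] avoid[OF _ uv(1), of 1] avoid[OF _ uv(1), of 2]
      avoid[OF _ uv(2), of 0] avoid[OF _ uv(2), of 1] avoid[OF _ uv(2), of 2]
      distinct[of 0 1] distinct[of 0 2] distinct[of 1 2]
    by (simp add: card_insert_if)
qed

theorem theorem2:
  fixes \<epsilon> :: real
  assumes "\<epsilon> > 0"
  shows "chromatic_number (UNIV :: (real ^ 2) set) (annulus_adj \<epsilon>) \<ge> 5"
proof -
  have "5 \<le> k" if k: "colourable (UNIV :: (real ^ 2) set) (annulus_adj \<epsilon>) k" for k
  proof (rule ccontr)
    assume "\<not> 5 \<le> k"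
    obtain c :: "real ^ 2 \<Rightarrow> nat" where c: "range c \<subseteq> {..<k}"
      and proper: "proper_colouring UNIV (annulus_adj \<epsilon>) c"
      using k unfolding colourable_def by blast
    \<comment> \<open>Shrinking the annulus keeps the colouring proper and ensures
      \<open>\<delta> < 1\<close>; then \<open>1 - \<delta> > 0\<close> also forces
      \<open>x \<noteq> y\<close>.\<close>
    define \<delta> where "\<delta> = min \<epsilon> (1/2)"
    show False
    proof (rule annulus_not_4_colourable[of \<delta> c])
      show "range c \<subseteq> {..<4}"
        using c \<open>\<not> 5 \<le> k\<close> by fastforce
      show "c x \<noteq> c y" if "1 - \<delta> \<le> dist x y" "dist x y \<le> 1 + \<delta>" for x y
      proof -
        have "annulus_adj \<epsilon> x y"
          using that by (auto simp: annulus_adj_def \<delta>_def dist_norm)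
        then show ?thesis
          using proper by (simp add: proper_colouring_def)
      qed
    qed (use assms in \<open>auto simp: \<delta>_def\<close>)
  qed
  then show ?thesis
    by (auto simp: chromatic_number_def le_INF_iff numeral_eq_enat)
qed

end
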